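(* Let $t_0>0$, $\alpha>0$, $\delta>0$, $\sigma\ge0$, $\mu>0$, $s\in(0,1)$, and $$\beta(t)=\mu\,\frac{e^{\frac1{\delta(1-s)}t^{1-s}}}{t^s}.$$ Let $\epsilon:[t_0,+\infty)\to\mathcal H_1$ satisfy $\int_{t_0}^{+\infty}t^{s/2}\|\epsilon(t)\|\,dt<+\infty$. Let $(x(t),\lambda(t))$ be a global solution on $[t_0,+\infty)$ of $$\begin{cases}\ddot x(t)+\alpha\dot x(t)=-\beta(t)\big(\nabla f(x(t))+A^T(\lambda(t)+\delta t^s\dot\lambda(t))+\sigma A^T(Ax(t)-b)\big)+\epsilon(t),\\ \ddot\lambda(t)+\alpha\dot\lambda(t)=\beta(t)\big(A(x(t)+\delta t^s\dot x(t))-b\big),\end{cases}$$ and let $(x^*,\lambda^* )\in\Omega$. Then $$|f(x(t))-f(x^* )|=\mathcal O\left(\frac1{e^{\frac1{\delta(1-s)}t^{1-s}}}\right),\qquad \|Ax(t)-b\|=\mathcal O\left(\frac1{e^{\frac1{\delta(1-s)}t^{1-s}}}\right).$$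
   Context: $\mathcal H_1,\mathcal H_2$ are real Hilbert spaces, $A:\mathcal H_1\to\mathcal H_2$ is a continuous linear operator with adjoint $A^T$, $b\in\mathcal H_2$, and $f:\mathcal H_1\to\mathbb R$ is convex and continuously differentiable. $\Omega\subset\mathcal H_1\times\mathcal H_2$ is the set of saddle points of the Lagrangian $\mathcal L(x,\lambda)=f(x)+\langle\lambda,Ax-b\rangle$, equivalently the set of pairs $(x^*,\lambda^* )$ with $\nabla f(x^* )=-A^T\lambda^*$ and $Ax^*=b$; it is assumed nonempty. A global solution of the system is a pair $(x,\lambda)$ with $x\in\mathcal C^2([t_0,+\infty),\mathcal H_1)$, $\lambda\in\mathcal C^2([t_0,+\infty),\mathcal H_2)$, such that $(x,\lambda)$ and $(\dot x,\dot\lambda)$ are locally absolutely continuous and the system holds for almost every $t\ge t_0$. All $\mathcal O(\cdot)$ are as $t\to+\infty$. *)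

theory Defs
  imports "HOL-Analysis.Analysis" "HOL-Library.Landau_Symbols"
begin

definition C1_fun :: "('a::real_normed_vector \<Rightarrow> real) \<Rightarrow> bool" where
  "C1_fun f \<longleftrightarrow>
     (\<exists>f' :: 'a \<Rightarrow> ('a \<Rightarrow>\<^sub>L real).
        (\<forall>x. (f has_derivative blinfun_apply (f' x)) (at x)) \<and> continuous_on UNIV f')"

definition gradient :: "('a::real_inner \<Rightarrow> real) \<Rightarrow> 'a \<Rightarrow> 'a" where
  "gradient f x = (THE D. GDERIV f x :> D)"

definition lagrangian ::
  "('a::real_inner \<Rightarrow> real) \<Rightarrow> ('a \<Rightarrow> 'b::real_inner) \<Rightarrow> 'b \<Rightarrow> 'a \<Rightarrow> 'b \<Rightarrow> real" where
  "lagrangian f A b x lam = f x + lam \<bullet> (A x - b)"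

definition saddle_points ::
  "('a::real_inner \<Rightarrow> real) \<Rightarrow> ('a \<Rightarrow> 'b::real_inner) \<Rightarrow> 'b \<Rightarrow> ('a \<times> 'b) set" where
  "saddle_points f A b =
     {(xs, lams). \<forall>x lam. lagrangian f A b xs lam \<le> lagrangian f A b xs lams \<and>
                      lagrangian f A b xs lams \<le> lagrangian f A b x lams}"

text \<open>\<open>z1\<close> and \<open>z2\<close> are the first and second derivatives of \<open>z\<close>, one-sided at \<open>t0\<close>.\<close>

definition C2_from :: "real \<Rightarrow> (real \<Rightarrow> 'a::real_normed_vector) \<Rightarrow>
    (real \<Rightarrow> 'a) \<Rightarrow> (real \<Rightarrow> 'a) \<Rightarrow> bool" where
  "C2_from t0 z z1 z2 \<longleftrightarrow>
     (\<forall>t\<ge>t0. (z has_vector_derivative z1 t) (at t within {t0..})) \<and>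
     (\<forall>t\<ge>t0. (z1 has_vector_derivative z2 t) (at t within {t0..})) \<and>
     continuous_on {t0..} z2"

definition abs_continuous_on :: "real \<Rightarrow> real \<Rightarrow> (real \<Rightarrow> 'a::real_normed_vector) \<Rightarrow> bool" where
  "abs_continuous_on c d z \<longleftrightarrow>
     (\<forall>e>0. \<exists>r>0. \<forall>(n::nat) u v.
        (\<forall>i<n. c \<le> u i \<and> u i \<le> v i \<and> v i \<le> d) \<and>
        (\<forall>i<n. \<forall>j<n. i \<noteq> j \<longrightarrow> {u i<..<v i} \<inter> {u j<..<v j} = {}) \<and>
        (\<Sum>i<n. v i - u i) < r
        \<longrightarrow> (\<Sum>i<n. norm (z (v i) - z (u i))) < e)"

definition locally_abs_continuous_from :: "real \<Rightarrow> (real \<Rightarrow> 'a::real_normed_vector) \<Rightarrow> bool" where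
  "locally_abs_continuous_from t0 z \<longleftrightarrow> (\<forall>T\<ge>t0. abs_continuous_on t0 T z)"

definition growth :: "real \<Rightarrow> real \<Rightarrow> real \<Rightarrow> real" where
  "growth \<delta> s t = exp (1 / (\<delta> * (1 - s)) * t powr (1 - s))"

definition scaling :: "real \<Rightarrow> real \<Rightarrow> real \<Rightarrow> real \<Rightarrow> real" where
  "scaling \<mu> \<delta> s t = \<mu> * (growth \<delta> s t / t powr s)"

definition global_solution ::
  "real \<Rightarrow> real \<Rightarrow> real \<Rightarrow> real \<Rightarrow> real \<Rightarrow> (real \<Rightarrow> real) \<Rightarrow>
   ('a::real_inner \<Rightarrow> real) \<Rightarrow> ('a \<Rightarrow> 'b::real_inner) \<Rightarrow> 'b \<Rightarrow> (real \<Rightarrow> 'a) \<Rightarrow>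
   (real \<Rightarrow> 'a) \<Rightarrow> (real \<Rightarrow> 'b) \<Rightarrow> bool" where
  "global_solution t0 \<alpha> \<delta> \<sigma> s \<beta> f A b \<epsilon> x lam \<longleftrightarrow>
     (\<exists>x1 x2 lam1 lam2.
        C2_from t0 x x1 x2 \<and> C2_from t0 lam lam1 lam2 \<and>
        locally_abs_continuous_from t0 (\<lambda>t. (x t, lam t)) \<and>
        locally_abs_continuous_from t0 (\<lambda>t. (x1 t, lam1 t)) \<and>
        (AE t in lebesgue. t \<ge> t0 \<longrightarrow>
           x2 t + \<alpha> *\<^sub>R x1 t =
             - (\<beta> t *\<^sub>R (gradient f (x t) + adjoint A (lam t + (\<delta> * t powr s) *\<^sub>R lam1 t)
                        + \<sigma> *\<^sub>R adjoint A (A (x t) - b))) + \<epsilon> t \<and>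
           lam2 t + \<alpha> *\<^sub>R lam1 t =
             \<beta> t *\<^sub>R (A (x t + (\<delta> * t powr s) *\<^sub>R x1 t) - b)))"

end

theory Submission
  imports Defs
begin

text \<open>
  Up to a null set, \<open>\<epsilon>\<close> is the continuous residual of the first equation, so the system may be assumed
  to hold everywhere. With \<open>\<theta>(t) = \<delta> t\<^sup>s\<close> and \<open>g\<close> the growth function, so that \<open>\<theta> g' = g\<close>, the energy \<open>E\<close> is
  \<open>\<delta>\<^sup>2 \<mu> g \<Phi>(x) + (\<parallel>u\<parallel>\<^sup>2 + \<parallel>w\<parallel>\<^sup>2) / (2 t\<^sup>s) + q (\<parallel>x - x\<^sup>*\<parallel>\<^sup>2 + \<parallel>\<lambda> - \<lambda>\<^sup>*\<parallel>\<^sup>2) / 2\<close>, where \<open>\<Phi>\<close> is the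
  augmented Lagrangian gap, \<open>u = x - x\<^sup>* + \<theta> x'\<close> and \<open>w = \<lambda> - \<lambda>\<^sup>* + \<theta> \<lambda>'\<close>. The weight
  \<open>q = \<alpha> \<delta> - t\<^sup>-\<^sup>s - \<delta> s / t\<close> is chosen so that the products \<open>\<langle>x - x\<^sup>*, x'\<rangle>\<close> and \<open>\<langle>\<lambda> - \<lambda>\<^sup>*, \<lambda>'\<rangle>\<close> cancel; \<open>q\<close> is
  increasing and bounded. What remains is \<open>E' \<le> (q'/q + \<delta> t\<^sup>s\<^sup>/\<^sup>2 \<parallel>\<epsilon>\<parallel>) (1 + E)\<close>, where \<open>q'/q\<close> is the derivative
  of the bounded function \<open>ln q\<close>, so Gronwall's lemma bounds \<open>E\<close> and gives \<open>\<Phi>(x) = O(1/g)\<close>. The second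
  equation says \<open>\<delta> \<mu> (g (A x - b))' = \<lambda>'' + \<alpha> \<lambda>'\<close>; integrating it gives \<open>A x - b = O(1/g)\<close> because
  \<open>\<lambda>\<close> and \<open>\<lambda>'\<close> are bounded.
\<close>

subsection \<open>Hilbert spaces and gradients\<close>

text \<open>The functional \<open>J\<close> is bounded below, and the parallelogram identity makes
  any minimising sequence Cauchy. Completeness gives a minimiser \<open>z\<close>, and the
  first-order condition at \<open>z\<close> is the representation.\<close>

lemma riesz_representation:
  fixes \<phi> :: "'a::{real_inner, complete_space} \<Rightarrow> real"
  assumes "bounded_linear \<phi>"
  obtains z where "\<And>x. \<phi> x = x \<bullet> z"
proof -
  interpret bounded_linear \<phi> by fact
  obtain K where K: "\<And>x. norm (\<phi> x) \<le> norm x * K" and "K > 0"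
    using pos_bounded by blast
  define J where "J x = (x \<bullet> x) / 2 - \<phi> x" for x
  have J_lower: "J x \<ge> - (K\<^sup>2 / 2)" for x
  proof -
    have "\<phi> x \<le> norm x * K" using K[of x] by simp
    moreover have "0 \<le> (norm x - K)\<^sup>2" by simp
    ultimately show ?thesis
      unfolding J_def by (simp add: power2_diff dot_square_norm)
  qed
  define m where "m = (INF x. J x)"
  have bdd: "bdd_below (range J)"
    using J_lower by (auto intro!: bdd_belowI2)
  have m_le: "m \<le> J x" for x
    unfolding m_def by (rule cINF_lower[OF bdd]) simp
  have "\<exists>x. J x < m + 1 / Suc n" for n :: nat
    using cINF_less_iff[OF _ bdd, of "m + 1 / Suc n"] unfolding m_def by simp
  then obtain X where X: "\<And>n::nat. J (X n) < m + 1 / Suc n"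
    by metis
  have dist_X: "(norm (X i - X j))\<^sup>2 \<le> 4 * (1 / Suc i + 1 / Suc j)" for i j
  proof -
    \<comment> \<open>Comparing the value at the midpoint with the infimum \<open>m\<close> bounds
      the distance of two near-minimisers.\<close>
    have "2 * J ((1/2) *\<^sub>R (X i + X j)) = J (X i) + J (X j) - (norm (X i - X j))\<^sup>2 / 4"
      unfolding J_def power2_norm_eq_inner
      by (simp add: scaleR add inner_add inner_diff inner_commute field_simps)
    then show ?thesis
      using m_le[of "(1/2) *\<^sub>R (X i + X j)"] X[of i] X[of j] by argo
  qed
  have "Cauchy X"
  proof (rule CauchyI)
    fix e :: real assume "e > 0"
    \<comment> \<open>For indices beyond \<open>N\<close>, \<open>dist_X\<close> bounds the squared
      distance by 4 (1/N + 1/N) = 8/N.\<close>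
    obtain N :: nat where N: "8 / e\<^sup>2 < N"
      using reals_Archimedean2 by blast
    have "norm (X i - X j) < e" if "i \<ge> N" "j \<ge> N" for i j
    proof (rule power2_less_imp_less)
      have N0: "real N > 0"
        using N \<open>e > 0\<close> by (smt (verit) divide_pos_pos zero_less_power)
      have "1 / real (Suc i) \<le> 1 / N" "1 / real (Suc j) \<le> 1 / N"
        using that N0 by (auto intro!: divide_left_mono)
      then have "(norm (X i - X j))\<^sup>2 \<le> 8 / N"
        using dist_X[of i j] by argo
      also have "8 / N < e\<^sup>2"
        using N N0 \<open>e > 0\<close> by (simp add: field_simps)
      finally show "(norm (X i - X j))\<^sup>2 < e\<^sup>2" .
    qed (use \<open>e > 0\<close> in simp)
    then show "\<exists>M. \<forall>m\<ge>M. \<forall>n\<ge>M. norm (X m - X n) < e" by blast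
  qed
  then obtain z where z: "X \<longlonglongrightarrow> z"
    using convergent_eq_Cauchy by blast
  have "(\<lambda>n. J (X n)) \<longlonglongrightarrow> J z"
    unfolding J_def by (intro tendsto_intros tendsto z) simp
  moreover have "(\<lambda>n. m + 1 / real (Suc n)) \<longlonglongrightarrow> m + 0"
    by (intro tendsto_intros LIMSEQ_Suc lim_inverse_n')
  ultimately have "J z \<le> m + 0"
    by (rule LIMSEQ_le) (use X in \<open>auto intro: less_imp_le\<close>)
  then have z_min: "J z \<le> J x" for x
    using m_le[of x] by simp
  have "\<phi> x = x \<bullet> z" for x
  proof -
    have d: "((\<lambda>t. J (z + t *\<^sub>R x)) has_real_derivative (x \<bullet> z - \<phi> x)) (at 0)"
      unfolding J_def add scaleR
      by (auto intro!: derivative_eq_intros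
          simp: inner_simps inner_commute has_real_derivative_iff_has_vector_derivative)
    have "x \<bullet> z - \<phi> x = 0"
      by (rule DERIV_local_min[OF d, of 1]) (use z_min in auto)
    then show ?thesis by simp
  qed
  then show thesis by (rule that)
qed

text \<open>\<open>adjoint\<close> is a choice operator, so its defining identity is available only
  once some adjoint exists. Riesz representation of \<open>\<lambda>x. A x \<bullet> y\<close>, for
  each \<open>y\<close>, supplies one.\<close>

lemma inner_adjoint:
  fixes A :: "'a::{real_inner, complete_space} \<Rightarrow> 'b::real_inner"
  assumes "bounded_linear A"
  shows "x \<bullet> adjoint A y = A x \<bullet> y"
proof -
  have "\<exists>z. \<forall>x. A x \<bullet> y = x \<bullet> z" for y
    by (rule riesz_representation[of "\<lambda>x. A x \<bullet> y"])
      (use assms bounded_linear_compose[OF bounded_linear_inner_left] in auto)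
  then have "\<exists>B. \<forall>x y. A x \<bullet> y = x \<bullet> B y" by metis
  then have "\<forall>x y. A x \<bullet> y = x \<bullet> adjoint A y"
    unfolding adjoint_def by (rule someI_ex)
  then show ?thesis by simp
qed

lemma bounded_linear_adjoint:
  fixes A :: "'a::{real_inner, complete_space} \<Rightarrow> 'b::real_inner"
  assumes "bounded_linear A"
  shows "bounded_linear (adjoint A)"
proof -
  interpret bounded_linear A by fact
  note adj = inner_adjoint[OF assms]
  obtain K where K: "\<And>x. norm (A x) \<le> norm x * K" and "K \<ge> 0"
    using nonneg_bounded by blast
  show ?thesis
  proof (rule bounded_linear_intro[where K = K])
    show "adjoint A (x + y) = adjoint A x + adjoint A y" for x y
      by (subst vector_eq_ldot[symmetric]) (simp add: inner_add_right adj)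
    show "adjoint A (r *\<^sub>R x) = r *\<^sub>R adjoint A x" for r x
      by (subst vector_eq_ldot[symmetric]) (simp add: adj)
    show "norm (adjoint A y) \<le> norm y * K" for y
    proof (cases "adjoint A y = 0")
      case True
      then show ?thesis
        using \<open>K \<ge> 0\<close> by simp
    next
      case False
      have "norm (adjoint A y) * norm (adjoint A y) = A (adjoint A y) \<bullet> y"
        by (metis adj power2_eq_square power2_norm_eq_inner)
      also have "\<dots> \<le> (norm (adjoint A y) * K) * norm y"
        by (meson K mult_right_mono norm_cauchy_schwarz norm_ge_zero order_trans)
      finally show ?thesis
        using False by (simp add: mult.assoc mult.commute)
    qed
  qed
qed

text \<open>\<open>gradient\<close> is a definite description: existence comes from the Riesz
  representative of the derivative, uniqueness from uniqueness of derivatives.\<close>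

lemma C1_fun_gderiv:
  fixes f :: "'a::{real_inner, complete_space} \<Rightarrow> real"
  assumes "C1_fun f"
  shows "GDERIV f x :> gradient f x"
proof -
  obtain f' :: "'a \<Rightarrow> 'a \<Rightarrow>\<^sub>L real" where f': "(f has_derivative f' x) (at x)"
    using assms unfolding C1_fun_def by blast
  obtain z where "blinfun_apply (f' x) = (\<lambda>h. h \<bullet> z)"
    using riesz_representation[OF blinfun.bounded_linear_right] by metis
  then have z: "GDERIV f x :> z"
    using f' unfolding gderiv_def by simp
  show ?thesis
    unfolding gradient_def
  proof (rule theI[where P = "\<lambda>D. GDERIV f x :> D", OF z])
    fix D assume "GDERIV f x :> D"
    then have "(\<lambda>h. h \<bullet> D) = (\<lambda>h. h \<bullet> z)"
      using z has_derivative_unique unfolding gderiv_def by blast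
    then show "D = z"
      by (metis vector_eq_ldot)
  qed
qed

text \<open>Passing from a functional to its representative does not increase distances: evaluate
  the difference of two derivatives at the difference of the two gradients.\<close>

lemma continuous_gradient:
  fixes f :: "'a::{real_inner, complete_space} \<Rightarrow> real"
  assumes "C1_fun f"
  shows "continuous_on UNIV (gradient f)"
proof -
  obtain f' :: "'a \<Rightarrow> 'a \<Rightarrow>\<^sub>L real" where f': "\<And>x. (f has_derivative f' x) (at x)"
    and cont: "continuous_on UNIV f'"
    using assms unfolding C1_fun_def by blast
  have grad: "f' x h = h \<bullet> gradient f x" for x h
    using has_derivative_unique[OF f'[of x] C1_fun_gderiv[OF assms, of x, unfolded gderiv_def]]
    by simp
  have le: "dist (gradient f x) (gradient f y) \<le> dist (f' x) (f' y)" for x y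
  proof (cases "gradient f x = gradient f y")
    case False
    let ?d = "gradient f x - gradient f y"
    have "norm ?d * norm ?d = (f' x - f' y) ?d"
      by (simp add: minus_blinfun.rep_eq grad inner_diff_right[symmetric] dot_square_norm power2_eq_square)
    also have "\<dots> \<le> norm (f' x - f' y) * norm ?d"
      using norm_blinfun[of "f' x - f' y" ?d] by simp
    finally show ?thesis
      using False by (simp add: dist_norm)
  qed simp
  show ?thesis
    using cont le unfolding continuous_on_iff by (meson order_le_less_trans)
qed

text \<open>Restricting \<open>f\<close> to the line through \<open>x\<close> and \<open>y\<close>
  reduces the claim to the tangent inequality for convex functions of one real variable.\<close>

lemma convex_gradient_inequality:
  fixes f :: "'a::real_inner \<Rightarrow> real"
  assumes "convex_on UNIV f" and "GDERIV f x :> D"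
  shows "f x - f y \<le> D \<bullet> (x - y)"
proof -
  define \<phi> where "\<phi> r = f (x + r *\<^sub>R (y - x))" for r :: real
  have "convex_on UNIV \<phi>"
  proof (rule convex_onI)
    fix t r r' :: real assume t: "0 < t" "t < 1"
    have "x + ((1 - t) *\<^sub>R r + t *\<^sub>R r') *\<^sub>R (y - x)
        = (1 - t) *\<^sub>R (x + r *\<^sub>R (y - x)) + t *\<^sub>R (x + r' *\<^sub>R (y - x))"
      by (simp add: algebra_simps)
    then show "\<phi> ((1 - t) *\<^sub>R r + t *\<^sub>R r') \<le> (1 - t) * \<phi> r + t * \<phi> r'"
      unfolding \<phi>_def using convex_onD[OF assms(1), of t] t by simp
  qed simp
  moreover have "(\<phi> has_real_derivative (y - x) \<bullet> D) (at 0)"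
  proof -
    have "(f has_derivative (\<lambda>h. h \<bullet> D)) (at (x + 0 *\<^sub>R (y - x)))"
      using assms(2) by (simp add: gderiv_def)
    then have "((\<lambda>r. f (x + r *\<^sub>R (y - x))) has_derivative (\<lambda>r. (r *\<^sub>R (y - x)) \<bullet> D)) (at 0)"
      by (rule has_derivative_compose[rotated]) (auto intro!: derivative_eq_intros)
    then show ?thesis
      unfolding \<phi>_def has_field_derivative_def by (simp add: mult.commute[of _ "(y - x) \<bullet> D"])
  qed
  ultimately have "\<phi> 1 - \<phi> 0 \<ge> (y - x) \<bullet> D * (1 - 0)"
    by (intro convex_on_imp_above_tangent[of UNIV]) auto
  then show ?thesis
    unfolding \<phi>_def by (simp add: inner_commute inner_diff_right)
qed

section \<open>Saddle points of the Lagrangian\<close>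

lemma saddle_point_feasible:
  assumes "(xs, lams) \<in> saddle_points f A b"
  shows "A xs = b"
proof -
  \<comment> \<open>Moving the multiplier along the constraint violation raises the Lagrangian by
    the squared norm of that violation, which must therefore vanish.\<close>
  have "lagrangian f A b xs (lams + (A xs - b)) \<le> lagrangian f A b xs lams"
    using assms unfolding saddle_points_def by blast
  then show ?thesis
    unfolding lagrangian_def by (simp add: inner_add_left not_less[symmetric])
qed

lemma saddle_point_lower_bound:
  assumes "(xs, lams) \<in> saddle_points f A b"
  shows "f xs \<le> f x + lams \<bullet> (A x - b)"
proof -
  have "lagrangian f A b xs lams \<le> lagrangian f A b x lams"
    using assms unfolding saddle_points_def by blast
  then show ?thesis
    unfolding lagrangian_def by (simp add: saddle_point_feasible[OF assms])
qed

section \<open>Null sets, a Gronwall estimate and derivatives of squared norms\<close>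

text \<open>The set where the functions differ is open and negligible, hence empty. This turns the
  system that holds almost everywhere into one that holds at every time after
  \<open>t0\<close>.\<close>

lemma AE_eq_continuous_imp_eq:
  fixes F G :: "'a::euclidean_space \<Rightarrow> 'b::real_normed_vector"
  assumes "open S" "continuous_on S F" "continuous_on S G"
    and "AE t in lebesgue. t \<in> S \<longrightarrow> F t = G t" and "t \<in> S"
  shows "F t = G t"
proof (rule ccontr)
  assume ne: "F t \<noteq> G t"
  let ?U = "S \<inter> (\<lambda>t. F t - G t) -` (- {0})"
  have "open ?U"
    using assms by (intro continuous_open_preimage continuous_intros) auto
  moreover have "?U \<noteq> {}" using ne \<open>t \<in> S\<close> by auto
  ultimately have "\<not> negligible ?U" by (rule open_not_negligible)
  moreover have "negligible ?U"
  proof (rule negligible_subset)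
    show "negligible {t. \<not> (t \<in> S \<longrightarrow> F t = G t)}"
      using assms(4) by (simp add: completion.AE_iff_null_sets negligible_iff_null_sets)
  qed auto
  ultimately show False by contradiction
qed

text \<open>Gronwall's lemma with integrating factor: \<open>V t * exp (- k t)\<close> is
  nonincreasing. The sign of \<open>V T\<close> matters only when \<open>k t\<close> is replaced by
  its bound \<open>K\<close>.\<close>

lemma bounded_of_deriv_le_mult:
  fixes V k :: "real \<Rightarrow> real"
  assumes V: "\<And>t. t \<ge> T \<Longrightarrow> (V has_real_derivative V' t) (at t)"
    and k: "\<And>t. t \<ge> T \<Longrightarrow> (k has_real_derivative k' t) (at t)"
    and le: "\<And>t. t \<ge> T \<Longrightarrow> V' t \<le> k' t * V t"
    and K: "\<And>t. t \<ge> T \<Longrightarrow> k t \<le> K"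
    and pos: "V T \<ge> 0" and "t \<ge> T"
  shows "V t \<le> V T * exp (K - k T)"
proof -
  have "V t * exp (- k t) \<le> V T * exp (- k T)"
  proof (rule DERIV_nonpos_imp_nonincreasing[OF \<open>T \<le> t\<close>])
    fix r assume r: "T \<le> r" "r \<le> t"
    have "((\<lambda>t. V t * exp (- k t)) has_real_derivative (V' r - k' r * V r) * exp (- k r)) (at r)"
      using V[of r] k[of r] r by (auto intro!: derivative_eq_intros simp: algebra_simps)
    moreover have "(V' r - k' r * V r) * exp (- k r) \<le> 0"
      using le[of r] r by (intro mult_nonpos_nonneg) auto
    ultimately show "\<exists>y. ((\<lambda>t. V t * exp (- k t)) has_real_derivative y) (at r) \<and> y \<le> 0" by blast
  qed
  then have "V t \<le> V T * exp (k t - k T)"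
    by (simp add: exp_diff exp_minus field_simps)
  also have "\<dots> \<le> V T * exp (K - k T)"
    using pos K[OF \<open>t \<ge> T\<close>] by (intro mult_left_mono) auto
  finally show ?thesis .
qed

lemma sq_norm_deriv:
  fixes z :: "real \<Rightarrow> 'c::real_inner"
  assumes "(z has_vector_derivative z') (at t)"
  shows "((\<lambda>t. (norm (z t))\<^sup>2) has_real_derivative 2 * (z t \<bullet> z')) (at t)"
  using bounded_bilinear.has_vector_derivative[OF bounded_bilinear_inner assms assms]
  by (simp add: has_real_derivative_iff_has_vector_derivative inner_commute power2_norm_eq_inner)

subsection \<open>The Lyapunov energy\<close>

text \<open>The regularised setting: \<open>R\<close> is a continuous perturbation, the equations
  hold at every time after \<open>t0\<close>, and excluding the endpoint makes all derivatives
  two-sided.\<close>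

locale primal_dual_flow =
  fixes f :: "'a::{real_inner, complete_space} \<Rightarrow> real"
    and A :: "'a \<Rightarrow> 'b::{real_inner, complete_space}"
    and b :: 'b
    and x x1 x2 R :: "real \<Rightarrow> 'a"
    and lam lam1 lam2 :: "real \<Rightarrow> 'b"
    and xs :: 'a and lams :: 'b
    and t0 \<alpha> \<delta> \<sigma> \<mu> s :: real
  assumes A: "bounded_linear A"
    and f_convex: "convex_on UNIV f" and f_C1: "C1_fun f"
    and params: "t0 > 0" "\<alpha> > 0" "\<delta> > 0" "\<sigma> \<ge> 0" "\<mu> > 0" "0 < s" "s < 1"
    and saddle: "(xs, lams) \<in> saddle_points f A b"
    and x_deriv: "\<And>t. t > t0 \<Longrightarrow> (x has_vector_derivative x1 t) (at t)"
    and x1_deriv: "\<And>t. t > t0 \<Longrightarrow> (x1 has_vector_derivative x2 t) (at t)"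
    and lam_deriv: "\<And>t. t > t0 \<Longrightarrow> (lam has_vector_derivative lam1 t) (at t)"
    and lam1_deriv: "\<And>t. t > t0 \<Longrightarrow> (lam1 has_vector_derivative lam2 t) (at t)"
    and primal: "\<And>t. t > t0 \<Longrightarrow> x2 t + \<alpha> *\<^sub>R x1 t =
             - (scaling \<mu> \<delta> s t *\<^sub>R (gradient f (x t) + adjoint A (lam t + (\<delta> * t powr s) *\<^sub>R lam1 t)
                        + \<sigma> *\<^sub>R adjoint A (A (x t) - b))) + R t"
    and dual: "\<And>t. t > t0 \<Longrightarrow> lam2 t + \<alpha> *\<^sub>R lam1 t =
             scaling \<mu> \<delta> s t *\<^sub>R (A (x t + (\<delta> * t powr s) *\<^sub>R x1 t) - b)"
    and R_continuous: "continuous_on {t0<..} R"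
    and R_integrable: "(\<lambda>t. t powr (s / 2) * norm (R t)) integrable_on {t0..}"
begin

lemmas A_xs = saddle_point_feasible[OF saddle]

definition residual :: "real \<Rightarrow> 'b" where
  "residual t = A (x t) - b"

definition gap :: "real \<Rightarrow> real" where
  "gap t = f (x t) - f xs + lams \<bullet> residual t + \<sigma> / 2 * (norm (residual t))\<^sup>2"

text \<open>The gradient in the primal variable of the augmented Lagrangian with multiplier
  \<open>lams\<close>, taken at \<open>x t\<close>.\<close>

definition gap_grad :: "real \<Rightarrow> 'a" where
  "gap_grad t = gradient f (x t) + adjoint A lams + \<sigma> *\<^sub>R adjoint A (residual t)"

definition primal_extrap :: "real \<Rightarrow> 'a" where
  "primal_extrap t = x t - xs + (\<delta> * t powr s) *\<^sub>R x1 t"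

definition dual_extrap :: "real \<Rightarrow> 'b" where
  "dual_extrap t = lam t - lams + (\<delta> * t powr s) *\<^sub>R lam1 t"

definition weight :: "real \<Rightarrow> real" where
  "weight t = \<alpha> * \<delta> - 1 / t powr s - \<delta> * s / t"

definition weight_deriv :: "real \<Rightarrow> real" where
  "weight_deriv t = s / (t * t powr s) + \<delta> * s / t\<^sup>2"

definition sqdist :: "real \<Rightarrow> real" where
  "sqdist t = (norm (x t - xs))\<^sup>2 + (norm (lam t - lams))\<^sup>2"

definition sqextrap :: "real \<Rightarrow> real" where
  "sqextrap t = (norm (primal_extrap t))\<^sup>2 + (norm (dual_extrap t))\<^sup>2"

definition energy :: "real \<Rightarrow> real" where
  "energy t = \<delta>\<^sup>2 * \<mu> * growth \<delta> s t * gap t + sqextrap t / (2 * t powr s)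
     + weight t / 2 * sqdist t"

section \<open>Signs and derivatives of the ingredients of the energy\<close>

lemma growth_pos: "growth \<delta> s t > 0"
  by (simp add: growth_def)

lemma growth_ge_1: "t > t0 \<Longrightarrow> growth \<delta> s t \<ge> 1"
  using params by (auto simp: growth_def)

lemma gap_nonneg: "gap t \<ge> 0"
  using saddle_point_lower_bound[OF saddle, of "x t"] params
  by (simp add: gap_def residual_def)

lemma residual_eq: "residual t = A (x t - xs)"
  by (simp add: residual_def A_xs linear_diff[OF bounded_linear.linear[OF A]])

lemma powr_minus_1: "t > t0 \<Longrightarrow> t powr (s - 1) = t powr s / t"
  using params by (simp add: powr_diff)

text \<open>The exponent of \<open>growth\<close> is a primitive of 1/(\<delta> t^s).\<close>

lemma growth_deriv:
  assumes "t > t0"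
  shows "(growth \<delta> s has_real_derivative growth \<delta> s t / (\<delta> * t powr s)) (at t)"
proof -
  have "((\<lambda>t. 1 / (\<delta> * (1 - s)) * t powr (1 - s)) has_real_derivative
      1 / (\<delta> * (1 - s)) * ((1 - s) * t powr (1 - s - 1))) (at t)"
    using assms params by (intro DERIV_cmult has_real_derivative_powr) simp
  moreover have "1 / (\<delta> * (1 - s)) * ((1 - s) * t powr (1 - s - 1)) = 1 / (\<delta> * t powr s)"
    using params by (simp add: powr_minus_divide)
  ultimately show ?thesis
    unfolding growth_def using DERIV_fun_exp by fastforce
qed

lemma weight_has_deriv:
  assumes "t > t0"
  shows "(weight has_real_derivative weight_deriv t) (at t)"
  unfolding weight_def weight_deriv_def using assms params
  by (auto intro!: derivative_eq_intros simp: powr_minus_1 power2_eq_square field_simps)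

lemma residual_deriv:
  assumes "t > t0"
  shows "(residual has_vector_derivative A (x1 t)) (at t)"
  unfolding residual_def
  using bounded_linear.has_vector_derivative[OF A x_deriv[OF assms]]
  by (auto intro!: derivative_eq_intros)

lemma gap_deriv:
  assumes "t > t0"
  shows "(gap has_real_derivative gap_grad t \<bullet> x1 t) (at t)"
proof -
  have "((\<lambda>t. f (x t)) has_derivative (\<lambda>h. (h *\<^sub>R x1 t) \<bullet> gradient f (x t))) (at t)"
    using C1_fun_gderiv[OF f_C1, of "x t"] x_deriv[OF assms]
    unfolding gderiv_def has_vector_derivative_def by (rule has_derivative_compose[rotated])
  then have "((\<lambda>t. f (x t)) has_real_derivative gradient f (x t) \<bullet> x1 t) (at t)"
    unfolding has_field_derivative_def
    by (simp add: mult.commute[of _ "x1 t \<bullet> gradient f (x t)"] inner_commute)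
  moreover have "((\<lambda>t. lams \<bullet> residual t) has_real_derivative lams \<bullet> A (x1 t)) (at t)"
    using bounded_linear.has_vector_derivative[OF bounded_linear_inner_right residual_deriv[OF assms]]
    by (simp add: has_real_derivative_iff_has_vector_derivative)
  moreover have "((\<lambda>t. residual t \<bullet> residual t) has_real_derivative 2 * (residual t \<bullet> A (x1 t))) (at t)"
    using bounded_bilinear.has_vector_derivative[OF bounded_bilinear_inner
        residual_deriv[OF assms] residual_deriv[OF assms]]
    by (simp add: has_real_derivative_iff_has_vector_derivative inner_commute)
  ultimately show ?thesis
    unfolding gap_def gap_grad_def power2_norm_eq_inner
    by (auto intro!: derivative_eq_intros
        simp: inner_add_left inner_commute[of "adjoint A _"] inner_adjoint[OF A] inner_commute[of "A _"])
qed

text \<open>The gradient inequality handles \<open>f\<close>. Paired with \<open>x t - xs\<close>,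
  the linear constraint term reproduces itself and the quadratic one doubles, which only helps since
  \<sigma> is nonnegative.\<close>

lemma gap_le: "gap t \<le> gap_grad t \<bullet> (x t - xs)"
proof -
  have "f (x t) - f xs \<le> gradient f (x t) \<bullet> (x t - xs)"
    by (rule convex_gradient_inequality[OF f_convex C1_fun_gderiv[OF f_C1]])
  moreover have "\<sigma> / 2 * (norm (residual t))\<^sup>2 \<le> \<sigma> * (norm (residual t))\<^sup>2"
    using params by simp
  moreover have "(gap_grad t - gradient f (x t)) \<bullet> (x t - xs)
      = lams \<bullet> residual t + \<sigma> * (norm (residual t))\<^sup>2"
    unfolding gap_grad_def power2_norm_eq_inner
    by (simp add: inner_add_left inner_commute[of "adjoint A _"] inner_adjoint[OF A]
        inner_commute[of "residual t" lams] flip: residual_eq)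
  ultimately show ?thesis
    unfolding gap_def by (simp add: inner_diff_left)
qed

lemma extrap_scale_deriv:
  assumes "t > t0"
  shows "((\<lambda>t. \<delta> * t powr s) has_real_derivative \<delta> * s * t powr s / t) (at t)"
  using assms params by (auto intro!: derivative_eq_intros simp: powr_minus_1)

text \<open>The velocity has coefficient 1 from \<open>x\<close>, \<delta> s t^s / t from the scale
  and - \<alpha> \<delta> t^s from the damping, which add up to
  \<open>- weight t * t powr s\<close>. The factor t^s also cancels the denominator of
  \<open>scaling\<close>.\<close>

lemma primal_extrap_deriv:
  assumes "t > t0"
  shows "(primal_extrap has_vector_derivative
     (\<delta> * t powr s) *\<^sub>R R t - (weight t * t powr s) *\<^sub>R x1 t
     - (\<delta> * \<mu> * growth \<delta> s t) *\<^sub>R (gap_grad t + adjoint A (dual_extrap t))) (at t)"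
proof -
  interpret B: bounded_linear "adjoint A" by (rule bounded_linear_adjoint[OF A])
  have t: "t powr s > 0" "t > 0" using assms params by auto
  have x2: "x2 t = R t - \<alpha> *\<^sub>R x1 t - scaling \<mu> \<delta> s t *\<^sub>R (gap_grad t + adjoint A (dual_extrap t))"
    using primal[OF assms]
    by (simp add: gap_grad_def dual_extrap_def residual_def B.add B.diff algebra_simps)
  have scal: "\<delta> * t powr s * scaling \<mu> \<delta> s t = \<delta> * \<mu> * growth \<delta> s t"
    using t by (simp add: scaling_def)
  have w: "weight t * t powr s = \<alpha> * (\<delta> * t powr s) - 1 - \<delta> * s * t powr s / t"
    using t by (simp add: weight_def field_simps)
  show ?thesis
    unfolding primal_extrap_def
    by (rule has_vector_derivative_eq_rhs[OF has_vector_derivative_add[OF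
          has_vector_derivative_diff[OF x_deriv[OF assms] has_vector_derivative_const]
          has_vector_derivative_scaleR[OF extrap_scale_deriv[OF assms] x1_deriv[OF assms]]]])
      (simp only: x2 scal[symmetric] w, simp add: algebra_simps)
qed

text \<open>Feasibility of \<open>xs\<close> turns the right-hand side of the dual equation into
  \<open>A\<close> applied to \<open>primal_extrap t\<close>, the counterpart of the adjoint term in
  the primal derivative.\<close>

lemma dual_extrap_deriv:
  assumes "t > t0"
  shows "(dual_extrap has_vector_derivative
     (\<delta> * \<mu> * growth \<delta> s t) *\<^sub>R A (primal_extrap t) - (weight t * t powr s) *\<^sub>R lam1 t) (at t)"
proof -
  interpret A: bounded_linear A by (rule A)
  have t: "t powr s > 0" "t > 0" using assms params by auto
  have lam2: "lam2 t = scaling \<mu> \<delta> s t *\<^sub>R A (primal_extrap t) - \<alpha> *\<^sub>R lam1 t"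
    using dual[OF assms]
    by (simp add: primal_extrap_def A.add A.diff A_xs algebra_simps)
  have scal: "\<delta> * t powr s * scaling \<mu> \<delta> s t = \<delta> * \<mu> * growth \<delta> s t"
    using t by (simp add: scaling_def)
  have w: "weight t * t powr s = \<alpha> * (\<delta> * t powr s) - 1 - \<delta> * s * t powr s / t"
    using t by (simp add: weight_def field_simps)
  show ?thesis
    unfolding dual_extrap_def
    by (rule has_vector_derivative_eq_rhs[OF has_vector_derivative_add[OF
          has_vector_derivative_diff[OF lam_deriv[OF assms] has_vector_derivative_const]
          has_vector_derivative_scaleR[OF extrap_scale_deriv[OF assms] lam1_deriv[OF assms]]]])
      (simp only: lam2 scal[symmetric] w, simp add: algebra_simps)
qed

section \<open>Dissipation and boundedness of the energy\<close>

text \<open>After the cancellations, the terms from convexity, from the decay of 1/t^s and from the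
  squared velocities are nonpositive. Only the growth of \<open>weight\<close> and the perturbation
  can increase the energy.\<close>

lemma energy_deriv:
  assumes "t > t0" and "weight t \<ge> 0"
  shows "\<exists>E'. (energy has_real_derivative E') (at t) \<and>
    E' \<le> weight_deriv t / 2 * sqdist t + \<delta> * norm (R t) * norm (primal_extrap t)"
proof -
  have t: "t > 0" "t powr s > 0" using assms params by auto
  define a where "a = t powr s"
  define g where "g = growth \<delta> s t"
  define D where "D = gap_grad t"
  define u where "u = primal_extrap t"
  define w where "w = dual_extrap t"
  define u' where "u' = (\<delta> * a) *\<^sub>R R t - (weight t * a) *\<^sub>R x1 t - (\<delta> * \<mu> * g) *\<^sub>R (D + adjoint A w)"
  define w' where "w' = (\<delta> * \<mu> * g) *\<^sub>R A u - (weight t * a) *\<^sub>R lam1 t"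
  define E' where "E' = \<delta> * \<mu> * g / a * gap t + \<delta>\<^sup>2 * \<mu> * g * (D \<bullet> x1 t)
     + (u \<bullet> u' + w \<bullet> w') / a - s * sqextrap t / (2 * t * a)
     + weight_deriv t / 2 * sqdist t
     + weight t * ((x t - xs) \<bullet> x1 t + (lam t - lams) \<bullet> lam1 t)"
  have a: "a > 0" using t by (simp add: a_def)
  have ext: "(sqextrap has_real_derivative 2 * (u \<bullet> u') + 2 * (w \<bullet> w')) (at t)"
    unfolding sqextrap_def
    using sq_norm_deriv[OF primal_extrap_deriv[OF assms(1)]] sq_norm_deriv[OF dual_extrap_deriv[OF assms(1)]]
    unfolding u_def w_def u'_def w'_def a_def g_def D_def by (rule DERIV_add)
  have dist: "(sqdist has_real_derivative 2 * ((x t - xs) \<bullet> x1 t) + 2 * ((lam t - lams) \<bullet> lam1 t)) (at t)"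
    unfolding sqdist_def
    by (intro DERIV_add sq_norm_deriv)
      (use x_deriv[OF assms(1)] lam_deriv[OF assms(1)] in \<open>auto intro!: derivative_eq_intros\<close>)
  \<comment> \<open>With the power as an opaque function, \<open>pw\<close> serves as its derivative
    rule.\<close>
  define P where "P r = r powr s" for r
  have pw: "(P has_real_derivative s * a / t) (at t)"
    unfolding P_def using t by (auto intro!: derivative_eq_intros simp: powr_minus_1[OF assms(1)] a_def)
  have Pt: "P t = a" by (simp add: P_def a_def)
  have energy_eq: "energy = (\<lambda>r. \<delta>\<^sup>2 * \<mu> * growth \<delta> s r * gap r + sqextrap r / (2 * P r)
      + weight r / 2 * sqdist r)"
    by (simp add: energy_def P_def fun_eq_iff)
  have "(energy has_real_derivative E') (at t)"
    unfolding energy_eq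
    using t params a
    by (auto intro!: derivative_eq_intros ext dist pw growth_deriv gap_deriv weight_has_deriv assms(1)
       simp: E'_def power2_eq_square field_simps Pt simp flip: a_def g_def D_def)
  moreover have "E' \<le> weight_deriv t / 2 * sqdist t + \<delta> * norm (R t) * norm u"
  proof -
    define c where "c = \<delta> * \<mu> * g / a"
    have c: "\<delta> * \<mu> * g = c * a" using a by (simp add: c_def)
    \<comment> \<open>The coupling terms \<open>u \<bullet> adjoint A w\<close> and
      \<open>w \<bullet> A u\<close> carry the same factor with opposite signs and cancel.\<close>
    have "u \<bullet> u' + w \<bullet> w' = \<delta> * a * (u \<bullet> R t) - weight t * a * (u \<bullet> x1 t + w \<bullet> lam1 t) - c * a * (u \<bullet> D)"
      unfolding u'_def w'_def c
      by (simp add: inner_diff_right inner_add_right inner_adjoint[OF A] inner_commute[of "A _"] algebra_simps)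
    then have "(u \<bullet> u' + w \<bullet> w') / a = \<delta> * (u \<bullet> R t) - weight t * (u \<bullet> x1 t + w \<bullet> lam1 t) - c * (u \<bullet> D)"
      using a by (simp add: field_simps)
    moreover have "\<delta>\<^sup>2 * \<mu> * g = \<delta> * (c * a)"
      by (simp add: power2_eq_square flip: c)
    moreover have "u \<bullet> x1 t = (x t - xs) \<bullet> x1 t + \<delta> * a * (norm (x1 t))\<^sup>2"
      "w \<bullet> lam1 t = (lam t - lams) \<bullet> lam1 t + \<delta> * a * (norm (lam1 t))\<^sup>2"
      "u \<bullet> D = D \<bullet> (x t - xs) + \<delta> * a * (D \<bullet> x1 t)"
      unfolding u_def w_def primal_extrap_def dual_extrap_def a_def[symmetric]
      by (simp_all add: inner_add_left inner_add_right power2_norm_eq_inner inner_commute[of _ D])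
    \<comment> \<open>Expanding \<open>u\<close> and \<open>w\<close> removes the products of
      displacement and velocity through \<open>weight\<close>, and the
      \<open>D \<bullet> x1 t\<close> terms because \<open>growth\<close> has derivative
      \<open>growth / (\<delta> * t powr s)\<close>.\<close>
    ultimately have "E' = weight_deriv t / 2 * sqdist t + \<delta> * (u \<bullet> R t)
       - c * (D \<bullet> (x t - xs) - gap t) - s * sqextrap t / (2 * t * a)
       - weight t * (\<delta> * a * ((norm (x1 t))\<^sup>2 + (norm (lam1 t))\<^sup>2))"
      unfolding E'_def c_def[symmetric] by (simp add: algebra_simps)
    moreover have "c * (D \<bullet> (x t - xs) - gap t) \<ge> 0"
      using gap_le[of t] params a growth_pos[of t] by (simp add: c_def D_def g_def)
    moreover have "s * sqextrap t / (2 * t * a) \<ge> 0"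
      using params a t by (simp add: sqextrap_def)
    moreover have "weight t * (\<delta> * a * ((norm (x1 t))\<^sup>2 + (norm (lam1 t))\<^sup>2)) \<ge> 0"
      using params a assms(2) by simp
    moreover have "\<delta> * (u \<bullet> R t) \<le> \<delta> * norm (R t) * norm u"
      using norm_cauchy_schwarz[of u "R t"] params by (simp add: mult.commute mult.left_commute)
    ultimately show ?thesis by linarith
  qed
  ultimately show ?thesis unfolding u_def by blast
qed

lemma weight_le: "t > t0 \<Longrightarrow> weight t \<le> \<alpha> * \<delta>"
  using params by (simp add: weight_def order_trans[of _ "0::real"])

lemma weight_eventually: "\<forall>\<^sub>F t in at_top. weight t > \<alpha> * \<delta> / 2"
proof -
  have "((\<lambda>t. t powr - s) \<longlongrightarrow> 0) at_top"
    using params by (intro tendsto_neg_powr filterlim_ident) auto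
  moreover have "((\<lambda>t. \<delta> * s / t) \<longlongrightarrow> 0) at_top"
    by (intro tendsto_divide_0[OF tendsto_const] filterlim_at_top_imp_at_infinity filterlim_ident)
  ultimately have "(weight \<longlongrightarrow> \<alpha> * \<delta> - 0 - 0) at_top"
    unfolding weight_def powr_minus_divide by (intro tendsto_intros)
  then show ?thesis
    using params by (intro order_tendstoD(1)) auto
qed

text \<open>All three summands of the energy are nonnegative, so each is bounded by the
  total.\<close>

lemma energy_parts:
  assumes "t > t0" and "weight t \<ge> 0"
  shows "\<delta>\<^sup>2 * \<mu> * growth \<delta> s t * gap t \<le> energy t"
    and "sqextrap t \<le> 2 * t powr s * energy t"
    and "weight t / 2 * sqdist t \<le> energy t"
proof -
  have "t powr s > 0" using assms params by simp
  moreover have "\<delta>\<^sup>2 * \<mu> * growth \<delta> s t * gap t \<ge> 0"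
    using params gap_nonneg[of t] growth_pos[of t] by simp
  moreover have "sqextrap t / (2 * t powr s) \<ge> 0"
    by (simp add: sqextrap_def)
  moreover have "weight t / 2 * sqdist t \<ge> 0"
    using assms by (simp add: sqdist_def)
  ultimately show "\<delta>\<^sup>2 * \<mu> * growth \<delta> s t * gap t \<le> energy t"
    "sqextrap t \<le> 2 * t powr s * energy t" "weight t / 2 * sqdist t \<le> energy t"
    using mult_left_mono[of "sqextrap t / (2 * t powr s)" "energy t" "2 * t powr s"]
    unfolding energy_def by simp_all
qed

text \<open>Gronwall's lemma for \<open>1 + energy\<close> with exponent \<open>k\<close>, which is
  bounded above because \<open>weight\<close> is at most \<alpha> \<delta> and \<open>\<rho>\<close>
  is integrable.\<close>

lemma energy_bounded: "\<exists>M. \<forall>\<^sub>F t in at_top. energy t \<le> M"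
proof -
  have "\<forall>\<^sub>F t in at_top. t > t0 \<and> weight t > \<alpha> * \<delta> / 2"
    by (intro eventually_conj eventually_gt_at_top weight_eventually)
  then obtain T where T: "\<And>t. t \<ge> T \<Longrightarrow> t > t0" "\<And>t. t \<ge> T \<Longrightarrow> weight t > \<alpha> * \<delta> / 2"
    unfolding eventually_at_top_linorder by blast
  have weight_pos: "weight t > 0" if "t \<ge> T" for t
    using T(2)[OF that] params by (smt (verit) divide_nonneg_nonneg mult_nonneg_nonneg)
  define \<rho> where "\<rho> t = t powr (s / 2) * norm (R t)" for t
  \<comment> \<open>The midpoint lies after \<open>t0\<close>, so \<open>\<rho>\<close> is
    continuous from \<open>T'\<close> on, and before \<open>T\<close>, so the integral has a
    two-sided derivative even at \<open>T\<close>.\<close>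
  define T' where "T' = (t0 + T) / 2"
  have T': "t0 < T'" "T' < T" using T(1)[of T] by (auto simp: T'_def)
  have \<rho>_integrable: "\<rho> integrable_on {t0..}"
    using R_integrable by (simp add: \<rho>_def[abs_def])
  have \<rho>_cont: "continuous_on {T'..t} \<rho>" for t
    unfolding \<rho>_def using T' params
    by (intro continuous_intros continuous_on_subset[OF R_continuous]) auto
  define k where "k t = ln (weight t) + \<delta> * integral {T'..t} \<rho>" for t
  define k' where "k' t = weight_deriv t / weight t + \<delta> * \<rho> t" for t
  have k: "(k has_real_derivative k' t) (at t)" if t: "t \<ge> T" for t
  proof -
    have "((\<lambda>r. integral {T'..r} \<rho>) has_real_derivative \<rho> t) (at t within {T'..t + 1})"
      using T' t by (intro integral_has_real_derivative \<rho>_cont) auto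
    then have "((\<lambda>r. integral {T'..r} \<rho>) has_real_derivative \<rho> t) (at t)"
      using T' t by (simp add: at_within_Icc_at)
    then show ?thesis
      unfolding k_def k'_def using T(1)[OF t] weight_pos[OF t]
      by (auto intro!: derivative_eq_intros weight_has_deriv)
  qed
  have k_le: "k t \<le> ln (\<alpha> * \<delta>) + \<delta> * integral {t0..} \<rho>" if t: "t \<ge> T" for t
  proof -
    have "integral {T'..t} \<rho> \<le> integral {t0..} \<rho>"
      using T' \<rho>_integrable
      by (intro integral_subset_le integrable_continuous_interval \<rho>_cont) (auto simp: \<rho>_def)
    moreover have "ln (weight t) \<le> ln (\<alpha> * \<delta>)"
      using weight_pos[OF t] weight_le[OF T(1)[OF t]] by simp
    ultimately show ?thesis
      unfolding k_def using params by (simp add: add_mono)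
  qed
  have "\<exists>E'. (energy has_real_derivative E') (at t) \<and> E' \<le> k' t * (1 + energy t)" if t: "t \<ge> T" for t
  proof -
    note t0 = T(1)[OF t] and w = weight_pos[OF t]
    note parts = energy_parts[OF t0 less_imp_le[OF w]]
    have tpos: "t > 0" using t0 params by simp
    obtain E' where E': "(energy has_real_derivative E') (at t)"
      "E' \<le> weight_deriv t / 2 * sqdist t + \<delta> * norm (R t) * norm (primal_extrap t)"
      using energy_deriv[OF t0] w by auto
    have wd: "weight_deriv t / weight t \<ge> 0"
      using tpos params w by (simp add: weight_deriv_def)
    have "weight_deriv t / 2 * sqdist t = weight_deriv t / weight t * (weight t / 2 * sqdist t)"
      using w by simp
    also have "\<dots> \<le> weight_deriv t / weight t * energy t"
      using wd parts(3) by (intro mult_left_mono)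
    also have "\<dots> \<le> weight_deriv t / weight t * (1 + energy t)"
      using wd by (intro mult_left_mono) auto
    finally have 1: "weight_deriv t / 2 * sqdist t \<le> weight_deriv t / weight t * (1 + energy t)" .
    \<comment> \<open>The extrapolation grows at most like t^(s/2), which is exactly the weight in
      the integrability hypothesis. The estimate is 2 p |u| <= |u|^2 + p^2 with p = t^(s/2).\<close>
    have "norm (primal_extrap t) \<le> t powr (s / 2) * (1 + energy t)"
    proof -
      define p where "p = t powr (s / 2)"
      have p: "p > 0" "t powr s = p\<^sup>2"
        using tpos by (auto simp: p_def power2_eq_square simp flip: powr_add)
      have "(norm (primal_extrap t))\<^sup>2 \<le> 2 * p\<^sup>2 * energy t"
        using parts(2) unfolding sqextrap_def p(2) by (smt (verit) zero_le_power2)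
      moreover have "0 \<le> (norm (primal_extrap t) - p)\<^sup>2"
        by simp
      ultimately have "2 * (p * norm (primal_extrap t)) \<le> p\<^sup>2 + 2 * p\<^sup>2 * energy t"
        by (simp add: power2_diff mult_ac)
      also have "\<dots> \<le> 2 * (p * (p * (1 + energy t)))"
        by (simp add: power2_eq_square algebra_simps)
      finally have "p * norm (primal_extrap t) \<le> p * (p * (1 + energy t))"
        by simp
      then show ?thesis
        using p(1) unfolding p_def[symmetric] by simp
    qed
    then have "\<delta> * norm (R t) * norm (primal_extrap t) \<le> \<delta> * norm (R t) * (t powr (s / 2) * (1 + energy t))"
      using params by (intro mult_left_mono) auto
    then have "\<delta> * norm (R t) * norm (primal_extrap t) \<le> \<delta> * \<rho> t * (1 + energy t)"
      by (simp add: \<rho>_def mult_ac)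
    with 1 E'(2) have "E' \<le> k' t * (1 + energy t)"
      unfolding k'_def distrib_right by linarith
    with E'(1) show ?thesis by blast
  qed
  then obtain E' where E': "\<And>t. t \<ge> T \<Longrightarrow> (energy has_real_derivative E' t) (at t)"
    "\<And>t. t \<ge> T \<Longrightarrow> E' t \<le> k' t * (1 + energy t)"
    by metis
  have "weight T / 2 * sqdist T \<ge> 0"
    using weight_pos[of T] by (simp add: sqdist_def)
  then have E_T: "1 + energy T \<ge> 0"
    using energy_parts(3)[of T] T(1)[of T] weight_pos[of T] by simp
  define M where "M = (1 + energy T) * exp (ln (\<alpha> * \<delta>) + \<delta> * integral {t0..} \<rho> - k T)"
  have "1 + energy t \<le> M" if "t \<ge> T" for t
    unfolding M_def
    by (rule bounded_of_deriv_le_mult[where V = "\<lambda>t. 1 + energy t" and V' = E' and k' = k'])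
      (use that k k_le E' E_T in \<open>auto intro!: derivative_eq_intros\<close>)
  then have "energy t \<le> M" if "t \<ge> T" for t
    using that by fastforce
  then show ?thesis
    by (blast intro: eventually_at_top_linorderI)
qed

section \<open>Decay rates of the residual and the objective\<close>

text \<open>By the dual equation the difference of the two time-dependent terms has zero derivative
  on an interval; \<open>c\<close> is its constant value.\<close>

lemma scaled_residual:
  "\<exists>c. \<forall>t>t0. growth \<delta> s t *\<^sub>R residual t = c + (1 / (\<delta> * \<mu>)) *\<^sub>R (lam1 t + \<alpha> *\<^sub>R lam t)"
proof -
  interpret A: bounded_linear A by (rule A)
  have "((\<lambda>t. growth \<delta> s t *\<^sub>R residual t - (1 / (\<delta> * \<mu>)) *\<^sub>R (lam1 t + \<alpha> *\<^sub>R lam t))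
      has_vector_derivative 0) (at t within {t0<..})" if t: "t \<in> {t0<..}" for t
  proof -
    have t0: "t > t0" using t by simp
    have pos: "t powr s > 0" using t0 params by simp
    have "lam2 t + \<alpha> *\<^sub>R lam1 t = scaling \<mu> \<delta> s t *\<^sub>R (residual t + (\<delta> * t powr s) *\<^sub>R A (x1 t))"
      using dual[OF t0] by (simp add: residual_def A.add A.scaleR algebra_simps)
    then have eq: "(1 / (\<delta> * \<mu>)) *\<^sub>R (lam2 t + \<alpha> *\<^sub>R lam1 t)
        = (growth \<delta> s t / (\<delta> * t powr s)) *\<^sub>R residual t + growth \<delta> s t *\<^sub>R A (x1 t)"
      using params pos by (simp add: scaling_def scaleR_add_right field_simps)
    have "((\<lambda>t. growth \<delta> s t *\<^sub>R residual t - (1 / (\<delta> * \<mu>)) *\<^sub>R (lam1 t + \<alpha> *\<^sub>R lam t))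
      has_vector_derivative (growth \<delta> s t *\<^sub>R A (x1 t) + (growth \<delta> s t / (\<delta> * t powr s)) *\<^sub>R residual t)
        - (1 / (\<delta> * \<mu>)) *\<^sub>R (lam2 t + \<alpha> *\<^sub>R lam1 t)) (at t)"
      by (intro has_vector_derivative_diff has_vector_derivative_scaleR growth_deriv residual_deriv
          bounded_linear.has_vector_derivative[OF bounded_linear_scaleR_right]
          has_vector_derivative_add lam_deriv lam1_deriv t0)
    then show ?thesis
      unfolding eq by (simp add: has_vector_derivative_at_within)
  qed
  then obtain c where "\<And>t. t \<in> {t0<..} \<Longrightarrow>
      growth \<delta> s t *\<^sub>R residual t - (1 / (\<delta> * \<mu>)) *\<^sub>R (lam1 t + \<alpha> *\<^sub>R lam t) = c"
    using has_vector_derivative_zero_constant[of "{t0<..}"] convex_real_interval by blast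
  then show ?thesis
    by (intro exI[of _ c]) (auto simp: algebra_simps)
qed

lemma growth_gap_bounded: "\<exists>K. \<forall>\<^sub>F t in at_top. growth \<delta> s t * gap t \<le> K"
proof -
  obtain M where "\<forall>\<^sub>F t in at_top. energy t \<le> M" using energy_bounded by blast
  then have "\<forall>\<^sub>F t in at_top. growth \<delta> s t * gap t \<le> M / (\<delta>\<^sup>2 * \<mu>)"
    using weight_eventually eventually_gt_at_top[of t0]
  proof eventually_elim
    case (elim t)
    have "weight t \<ge> 0"
      using elim params by (smt (verit) divide_nonneg_nonneg mult_nonneg_nonneg)
    from energy_parts(1)[OF elim(3) this] show ?case
      using elim(1) params by (simp add: field_simps)
  qed
  then show ?thesis by blast
qed

text \<open>The multiplier is bounded because \<open>weight\<close> stays above \<alpha> \<delta> /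
  2. Its velocity is (\<open>dual_extrap t\<close> - (\<open>lam t - lams\<close>)) / (\<delta>
  t^s), whose numerator is O(t^(s/2)).\<close>

lemma multiplier_bounded: "\<exists>K. \<forall>\<^sub>F t in at_top. norm (lam1 t + \<alpha> *\<^sub>R lam t) \<le> K"
proof -
  obtain M where "\<forall>\<^sub>F t in at_top. energy t \<le> M" using energy_bounded by blast
  \<comment> \<open>\<open>N\<close> bounds the distance of the multiplier from \<open>lams\<close>:
    \<alpha> \<delta> / 4 times its square is at most the energy.\<close>
  define N where "N = sqrt (4 * M / (\<alpha> * \<delta>))"
  have "\<forall>\<^sub>F t in at_top. norm (lam1 t + \<alpha> *\<^sub>R lam t) \<le> (sqrt (2 * M) + N) / \<delta> + \<alpha> * (N + norm lams)"
    using \<open>\<forall>\<^sub>F t in at_top. energy t \<le> M\<close> weight_eventually eventually_gt_at_top[of t0] eventually_ge_at_top[of 1]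
  proof eventually_elim
    case (elim t)
    have pos: "\<alpha> * \<delta> > 0" using params by simp
    then have w: "weight t \<ge> 0" using elim by simp
    note parts = energy_parts[OF elim(3) w]
    define p where "p = t powr s"
    have p: "p \<ge> 1" using elim params by (simp add: p_def ge_one_powr_ge_zero)
    have sq0: "(norm (lam t - lams))\<^sup>2 \<le> sqdist t" "(norm (dual_extrap t))\<^sup>2 \<le> sqextrap t"
      by (simp_all add: sqdist_def sqextrap_def)
    have "\<alpha> * \<delta> / 4 * (norm (lam t - lams))\<^sup>2 \<le> weight t / 2 * sqdist t"
      using elim(2) sq0 pos by (intro mult_mono) auto
    also have "\<dots> \<le> M" using parts(3) elim(1) by simp
    finally have "(norm (lam t - lams))\<^sup>2 \<le> 4 * M / (\<alpha> * \<delta>)"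
      using pos by (simp add: field_simps)
    then have nu: "norm (lam t - lams) \<le> N"
      unfolding N_def by (rule real_le_rsqrt)
    have "(norm (dual_extrap t))\<^sup>2 \<le> 2 * p * energy t"
      using sq0 parts(2) by (simp add: p_def)
    also have "\<dots> \<le> 2 * p * M" using elim(1) p by (intro mult_left_mono) auto
    also have "\<dots> = p * (2 * M)" by simp
    \<comment> \<open>Since p >= 1, enlarging p to its square costs nothing essential and lets the
      square root produce the factor p that is divided out below.\<close>
    also have "\<dots> \<le> p\<^sup>2 * (2 * M)"
    proof (rule mult_right_mono)
      show "p \<le> p\<^sup>2" using p by (simp add: power2_eq_square)
      have "0 \<le> weight t / 2 * sqdist t" using w by (simp add: sqdist_def)
      then show "0 \<le> 2 * M" using parts(3) elim(1) by simp
    qed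
    finally have "norm (dual_extrap t) \<le> sqrt (p\<^sup>2 * (2 * M))" by (rule real_le_rsqrt)
    then have dual: "norm (dual_extrap t) \<le> p * sqrt (2 * M)"
      using p by (simp add: real_sqrt_mult)
    have "(\<delta> * p) *\<^sub>R lam1 t = dual_extrap t - (lam t - lams)"
      by (simp add: dual_extrap_def p_def)
    then have "\<delta> * p * norm (lam1 t) \<le> norm (dual_extrap t) + norm (lam t - lams)"
      using norm_triangle_ineq4[of "dual_extrap t" "lam t - lams"] params p
      by (metis abs_of_nonneg mult_nonneg_nonneg less_imp_le norm_scaleR order_trans zero_le_one)
    also have "\<dots> \<le> p * sqrt (2 * M) + p * N"
    proof (rule add_mono[OF dual])
      have "N \<ge> 0" using nu norm_ge_zero order_trans by blast
      then show "norm (lam t - lams) \<le> p * N"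
        using nu p mult_right_mono[of 1 p N] by simp
    qed
    finally have "p * (\<delta> * norm (lam1 t)) \<le> p * (sqrt (2 * M) + N)"
      by (simp add: algebra_simps)
    then have "\<delta> * norm (lam1 t) \<le> sqrt (2 * M) + N"
      using p by simp
    then have "norm (lam1 t) \<le> (sqrt (2 * M) + N) / \<delta>"
      using params p by (simp add: field_simps)
    moreover have "norm (lam t) \<le> N + norm lams"
      using nu norm_triangle_sub[of "lam t" lams] by simp
    then have "norm (\<alpha> *\<^sub>R lam t) \<le> \<alpha> * (N + norm lams)"
      using params by simp
    ultimately show ?case by (rule norm_triangle_mono)
  qed
  then show ?thesis by blast
qed

lemma growth_residual_bounded: "\<exists>K. \<forall>\<^sub>F t in at_top. growth \<delta> s t * norm (residual t) \<le> K"
proof -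
  obtain c where c: "\<And>t. t > t0 \<Longrightarrow>
      growth \<delta> s t *\<^sub>R residual t = c + (1 / (\<delta> * \<mu>)) *\<^sub>R (lam1 t + \<alpha> *\<^sub>R lam t)"
    using scaled_residual by blast
  obtain K where "\<forall>\<^sub>F t in at_top. norm (lam1 t + \<alpha> *\<^sub>R lam t) \<le> K"
    using multiplier_bounded by blast
  then have "\<forall>\<^sub>F t in at_top. growth \<delta> s t * norm (residual t) \<le> norm c + 1 / (\<delta> * \<mu>) * K"
    using eventually_gt_at_top[of t0]
  proof eventually_elim
    case (elim t)
    have "growth \<delta> s t * norm (residual t) = norm (growth \<delta> s t *\<^sub>R residual t)"
      using growth_pos[of t] by simp
    also have "\<dots> \<le> norm c + norm ((1 / (\<delta> * \<mu>)) *\<^sub>R (lam1 t + \<alpha> *\<^sub>R lam t))"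
      unfolding c[OF elim(2)] by (rule norm_triangle_ineq)
    also have "norm ((1 / (\<delta> * \<mu>)) *\<^sub>R (lam1 t + \<alpha> *\<^sub>R lam t)) \<le> 1 / (\<delta> * \<mu>) * K"
      using elim(1) params by (simp add: divide_right_mono)
    finally show ?case by simp
  qed
  then show ?thesis by blast
qed

lemma residual_bigo: "(\<lambda>t. norm (A (x t) - b)) \<in> O[at_top](\<lambda>t. 1 / growth \<delta> s t)"
proof -
  obtain K where "\<forall>\<^sub>F t in at_top. growth \<delta> s t * norm (residual t) \<le> K"
    using growth_residual_bounded by blast
  then have "\<forall>\<^sub>F t in at_top. norm (norm (A (x t) - b)) \<le> K * norm (1 / growth \<delta> s t)"
    by eventually_elim (use growth_pos in \<open>simp add: residual_def field_simps abs_of_pos\<close>)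
  then show ?thesis by (rule bigoI)
qed

text \<open>The objective difference is \<open>gap\<close> minus the linear and quadratic residual
  terms, and each of these is of order 1/\<open>growth\<close>.\<close>

lemma objective_bigo: "(\<lambda>t. \<bar>f (x t) - f xs\<bar>) \<in> O[at_top](\<lambda>t. 1 / growth \<delta> s t)"
proof -
  obtain K where K: "\<forall>\<^sub>F t in at_top. growth \<delta> s t * norm (residual t) \<le> K"
    using growth_residual_bounded by blast
  obtain K' where K': "\<forall>\<^sub>F t in at_top. growth \<delta> s t * gap t \<le> K'"
    using growth_gap_bounded by blast
  have "\<forall>\<^sub>F t in at_top. norm (\<bar>f (x t) - f xs\<bar>)
     \<le> (K' + norm lams * K + \<sigma> / 2 * K\<^sup>2) * norm (1 / growth \<delta> s t)"
    using K K' eventually_gt_at_top[of t0]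
  proof eventually_elim
    case (elim t)
    define g where "g = growth \<delta> s t"
    define r where "r = norm (residual t)"
    have g: "g \<ge> 1" using growth_ge_1[OF elim(3)] by (simp add: g_def)
    have r: "r \<ge> 0" "g * r \<le> K" using elim(1) by (auto simp: r_def g_def)
    \<comment> \<open>Here g >= 1 is used: the squared residual decays even faster than
      required.\<close>
    have "g * r\<^sup>2 \<le> (g * r)\<^sup>2"
      using g mult_right_mono[of g "g\<^sup>2" "r\<^sup>2"] self_le_power[of g 2] by (simp add: power_mult_distrib)
    also have "\<dots> \<le> K\<^sup>2"
      using r g by (intro power_mono) auto
    finally have r2: "g * r\<^sup>2 \<le> K\<^sup>2" .
    have "\<bar>f (x t) - f xs\<bar> \<le> gap t + norm lams * r + \<sigma> / 2 * r\<^sup>2"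
      using gap_nonneg[of t] Cauchy_Schwarz_ineq2[of lams "residual t"] params
      unfolding gap_def r_def by (smt (verit) mult_nonneg_nonneg divide_nonneg_nonneg zero_le_power2)
    then have "g * \<bar>f (x t) - f xs\<bar> \<le> g * (gap t + norm lams * r + \<sigma> / 2 * r\<^sup>2)"
      using g by (intro mult_left_mono) auto
    also have "\<dots> = g * gap t + norm lams * (g * r) + \<sigma> / 2 * (g * r\<^sup>2)"
      by (simp add: algebra_simps)
    also have "\<dots> \<le> K' + norm lams * K + \<sigma> / 2 * K\<^sup>2"
      using elim(2) r r2 params unfolding g_def by (intro add_mono mult_left_mono) auto
    finally show ?case
      using g unfolding g_def[symmetric] by (simp add: field_simps)
  qed
  then show ?thesis by (rule bigoI)
qed

end

section \<open>Reduction of the almost-everywhere system to the regular flow\<close>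

theorem theorem2p3:
  fixes f :: "'a::{real_inner, complete_space} \<Rightarrow> real"
    and A :: "'a \<Rightarrow> 'b::{real_inner, complete_space}"
    and b :: 'b
    and \<epsilon> x :: "real \<Rightarrow> 'a"
    and lam :: "real \<Rightarrow> 'b"
    and xs :: 'a and lams :: 'b
    and t0 \<alpha> \<delta> \<sigma> \<mu> s :: real
  assumes "bounded_linear A"
    and "convex_on UNIV f" and "C1_fun f"
    and "t0 > 0" and "\<alpha> > 0" and "\<delta> > 0" and "\<sigma> \<ge> 0" and "\<mu> > 0" and "0 < s" and "s < 1"
    and "(\<lambda>t. t powr (s / 2) * norm (\<epsilon> t)) absolutely_integrable_on {t0..}"
    and "global_solution t0 \<alpha> \<delta> \<sigma> s (scaling \<mu> \<delta> s) f A b \<epsilon> x lam"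
    and "(xs, lams) \<in> saddle_points f A b"
  shows "(\<lambda>t. \<bar>f (x t) - f xs\<bar>) \<in> O[at_top](\<lambda>t. 1 / growth \<delta> s t) \<and>
           (\<lambda>t. norm (A (x t) - b)) \<in> O[at_top](\<lambda>t. 1 / growth \<delta> s t)"
proof -
  obtain x1 x2 lam1 lam2 where C2: "C2_from t0 x x1 x2" "C2_from t0 lam lam1 lam2"
    and AE: "AE t in lebesgue. t \<ge> t0 \<longrightarrow>
           x2 t + \<alpha> *\<^sub>R x1 t =
             - (scaling \<mu> \<delta> s t *\<^sub>R (gradient f (x t) + adjoint A (lam t + (\<delta> * t powr s) *\<^sub>R lam1 t)
                        + \<sigma> *\<^sub>R adjoint A (A (x t) - b))) + \<epsilon> t \<and>
           lam2 t + \<alpha> *\<^sub>R lam1 t =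
             scaling \<mu> \<delta> s t *\<^sub>R (A (x t + (\<delta> * t powr s) *\<^sub>R x1 t) - b)"
    using assms(12) unfolding global_solution_def by blast
  \<comment> \<open>Solving the first equation for the perturbation gives a continuous function that
    agrees with \<open>\<epsilon>\<close> almost everywhere; with \<open>R\<close> in its place the
    primal equation holds by definition.\<close>
  define R where "R t = x2 t + \<alpha> *\<^sub>R x1 t +
     scaling \<mu> \<delta> s t *\<^sub>R (gradient f (x t) + adjoint A (lam t + (\<delta> * t powr s) *\<^sub>R lam1 t)
                        + \<sigma> *\<^sub>R adjoint A (A (x t) - b))" for t
  have deriv_at: "(z has_vector_derivative z') (at t)"
    if "(z has_vector_derivative z') (at t within {t0..})" "t > t0" for z :: "real \<Rightarrow> 'c::real_normed_vector" and z' t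
    using that by (metis at_within_interior interior_real_atLeast greaterThan_iff)
  note x_deriv = C2(1)[unfolded C2_from_def] and lam_deriv = C2(2)[unfolded C2_from_def]
  have sub: "{t0<..} \<subseteq> {t0..}" by auto
  have cont: "continuous_on {t0<..} x" "continuous_on {t0<..} x1" "continuous_on {t0<..} x2"
    "continuous_on {t0<..} lam" "continuous_on {t0<..} lam1" "continuous_on {t0<..} lam2"
    using x_deriv lam_deriv
    by (auto intro!: continuous_on_subset[OF _ sub] intro: continuous_on_vector_derivative[where f' = x1]
        continuous_on_vector_derivative[where f' = x2] continuous_on_vector_derivative[where f' = lam1]
        continuous_on_vector_derivative[where f' = lam2])
  have scaling_cont: "continuous_on {t0<..} (scaling \<mu> \<delta> s)"
    unfolding scaling_def growth_def using assms(4) by (intro continuous_intros) auto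
  have R_cont: "continuous_on {t0<..} R"
    unfolding R_def using assms(4)
    by (intro continuous_intros cont scaling_cont
        continuous_on_compose2[OF continuous_gradient[OF assms(3)]]
        bounded_linear.continuous_on[OF bounded_linear_adjoint[OF assms(1)]]
        bounded_linear.continuous_on[OF assms(1)]) auto
  have dual: "lam2 t + \<alpha> *\<^sub>R lam1 t = scaling \<mu> \<delta> s t *\<^sub>R (A (x t + (\<delta> * t powr s) *\<^sub>R x1 t) - b)"
    if "t > t0" for t
  proof (rule AE_eq_continuous_imp_eq[where S = "{t0<..}"])
    show "continuous_on {t0<..} (\<lambda>t. scaling \<mu> \<delta> s t *\<^sub>R (A (x t + (\<delta> * t powr s) *\<^sub>R x1 t) - b))"
      using assms(4)
      by (intro continuous_intros cont scaling_cont bounded_linear.continuous_on[OF assms(1)]) auto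
    show "AE t in lebesgue. t \<in> {t0<..} \<longrightarrow>
        lam2 t + \<alpha> *\<^sub>R lam1 t = scaling \<mu> \<delta> s t *\<^sub>R (A (x t + (\<delta> * t powr s) *\<^sub>R x1 t) - b)"
      using AE by eventually_elim auto
    show "continuous_on {t0<..} (\<lambda>t. lam2 t + \<alpha> *\<^sub>R lam1 t)"
      by (intro continuous_intros cont)
  qed (use that in simp_all)
  have "AE t in lebesgue. t \<ge> t0 \<longrightarrow> R t = \<epsilon> t"
    using AE by eventually_elim (simp add: R_def)
  then obtain N where N: "negligible N" "\<And>t. t \<ge> t0 \<Longrightarrow> t \<notin> N \<Longrightarrow> R t = \<epsilon> t"
    unfolding eventually_ae_filter_negligible by blast
  \<comment> \<open>Integrability passes from \<open>\<epsilon>\<close> to \<open>R\<close> because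
    they differ only on the negligible set \<open>N\<close>.\<close>
  have "(\<lambda>t. t powr (s / 2) * norm (R t)) integrable_on {t0..}"
    by (rule integrable_spike[OF set_lebesgue_integral_eq_integral(1)[OF assms(11)] N(1)]) (use N(2) in auto)
  then interpret primal_dual_flow f A b x x1 x2 R lam lam1 lam2 xs lams t0 \<alpha> \<delta> \<sigma> \<mu> s
    by (intro primal_dual_flow.intro assms R_cont dual)
      (use x_deriv lam_deriv in \<open>simp_all add: R_def deriv_at\<close>)
  show ?thesis
    using objective_bigo residual_bigo by blast
qed

end
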